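(* The following hold. (1) $drn(K_n)=n$ for every $n\in\mathbb{N}$. (2) $drn(K_n-K_2)=n$ for every positive integer $n\geq 4$. (3) If $G$ is a graph of order $n$ and $q(G^c)\geq 2$, then $drn(G)\leq (n-1)\,q(G^c)$.
   Context: All graphs are finite, simple and undirected; $\mathbb{N}$ is the set of positive integers. For a graph $G$, $G^c$ denotes its complement and $q(G)$ its number of edges; the order of $G$ is its number of vertices. $K_n$ is the complete graph on $n$ vertices and $K_n-K_2$ is the graph obtained from $K_n$ by deleting one edge. For a positive integer $k$, $[k]=\{1,\dots,k\}$ and $S_k$ is the group of permutations of $[k]$. A derangement $k$-representation of a graph $G$ is an injective map $\pi:V(G)\to S_k$ such that for any two distinct vertices $u,v$ of $G$, $u$ and $v$ are adjacent if and only if $\pi(v)(i)\neq\pi(u)(i)$ for all $i\in[k]$. The derangement representation number $drn(G)$ is the minimum $k$ such that $G$ has a derangement $k$-representation. (An assertion $drn(G)\le N$ or $drn(G)=N$ includes the assertion that such a $k$ exists.) *)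

theory Defs
  imports Main "HOL-Library.Extended_Nat" "HOL-Library.Ramsey" "HOL-Combinatorics.Permutations"
begin

text \<open>Edges are two-element sets of vertices; \<^term>\<open>nsets V 2\<close> is the set of
  all two-element subsets of \<^term>\<open>V\<close>.\<close>

datatype 'a graph = Graph (verts: "'a set") (edges: "'a set set")

definition finite_simple_graph :: "'a graph \<Rightarrow> bool" where
  "finite_simple_graph G \<longleftrightarrow> finite (verts G) \<and> edges G \<subseteq> nsets (verts G) 2"

definition order :: "'a graph \<Rightarrow> nat" where
  "order G = card (verts G)"

definition num_edges :: "'a graph \<Rightarrow> nat" where
  "num_edges G = card (edges G)"

definition adjacent :: "'a graph \<Rightarrow> 'a \<Rightarrow> 'a \<Rightarrow> bool" where
  "adjacent G u v \<longleftrightarrow> {u, v} \<in> edges G"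

definition complement :: "'a graph \<Rightarrow> 'a graph" where
  "complement G = Graph (verts G) (nsets (verts G) 2 - edges G)"

definition complete_graph :: "'a set \<Rightarrow> 'a graph" where
  "complete_graph V = Graph V (nsets V 2)"

definition delete_edge :: "'a graph \<Rightarrow> 'a set \<Rightarrow> 'a graph" where
  "delete_edge G e = Graph (verts G) (edges G - {e})"

definition derangement_representation ::
    "nat \<Rightarrow> 'a graph \<Rightarrow> ('a \<Rightarrow> nat \<Rightarrow> nat) \<Rightarrow> bool" where
  "derangement_representation k G \<pi> \<longleftrightarrow>
     (\<forall>v\<in>verts G. \<pi> v permutes {1..k}) \<and> inj_on \<pi> (verts G) \<and>
     (\<forall>u\<in>verts G. \<forall>v\<in>verts G. u \<noteq> v \<longrightarrow>
        (adjacent G u v \<longleftrightarrow> (\<forall>i\<in>{1..k}. \<pi> v i \<noteq> \<pi> u i)))"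

text \<open>The infimum over \<^typ>\<open>enat\<close> is a minimum when some representation exists and
  infinity otherwise, so a finite value or upper bound includes existence. The
  requirement that \<open>k\<close> be positive matters: a one-vertex graph would
  otherwise get the value \<open>0\<close>.\<close>

definition drn :: "'a graph \<Rightarrow> enat" where
  "drn G = (INF k\<in>{k. k \<ge> 1 \<and> (\<exists>\<pi>. derangement_representation k G \<pi>)}. enat k)"

end

theory Submission imports Defs
begin

text \<open>Only the number of positions matters for a representation, so the positions may be the
  elements of any finite set (\<open>representation_on_positions\<close>); sets of the form
  \<open>{0..<m}\<close> with addition modulo \<open>m\<close> and products of such sets are convenient.

  Lower bounds come from evaluating at a single position: the values taken there by the members
  of a clique are pairwise different, so \<open>k\<close> is at least the size of a clique. For \<open>K\<^sub>n - xy\<close>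
  this gives only \<open>n - 1\<close>. If \<open>k\<close> were \<open>n - 1\<close>, the clique \<open>V - {x}\<close> would use
  every value at every position; the value of \<open>x\<close> would then have to be that of its only
  non-neighbour \<open>y\<close>, so \<open>x\<close> and \<open>y\<close> would receive the same permutation.

  For the upper bounds, the \<open>n\<close> cyclic shifts represent \<open>K\<^sub>n\<close>. For \<open>K\<^sub>n - xy\<close> one keeps
  the shifts by \<open>2, \<dots>, n - 2\<close> and replaces those by \<open>0\<close>, \<open>1\<close> and \<open>-1\<close> by three involutions
  that move every point by at most one step around the cycle. The product \<open>C\<close> of the two disjoint
  adjacent transpositions \<open>(n-3 n-2)\<close> and \<open>(n-1 0)\<close> of \<open>{0, \<dots>, n-1}\<close> cuts the cycle
  into the segments \<open>{n-2, n-1}\<close> and \<open>{0, \<dots>, n-3}\<close>, and on each segment the remaining steps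
  still contain permutations avoiding \<open>C\<close>: both the identity and the swap on the first segment,
  and a pairing of neighbours on the second. The permutations of \<open>x\<close> and \<open>y\<close> share the
  pairing and differ on the short segment.

  For an arbitrary \<open>G\<close>, take one block of \<open>n - 1\<close> positions for every missing edge \<open>e\<close>, and
  in that block let the vertices act by shifts that are distinct except that the two ends of \<open>e\<close>
  coincide. Two vertices agree somewhere exactly if they form a missing edge, and then only
  in the block of that edge; as there is a second block, the permutations are still
  different.\<close>

section \<open>Changing the set of positions\<close>

text \<open>Conjugation by a bijection from \<open>{1..k}\<close> to the set of positions turns such a family of
  bijections into permutations of \<open>{1..k}\<close>, which must be extended by the identity.\<close>

lemma representation_on_positions:
  fixes S :: "'b set"
  assumes S: "finite S" "card S = k"
    and bij: "\<And>v. v \<in> verts G \<Longrightarrow> bij_betw (\<rho> v) S S"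
    and adj: "\<And>u v. u \<in> verts G \<Longrightarrow> v \<in> verts G \<Longrightarrow> u \<noteq> v \<Longrightarrow>
                adjacent G u v \<longleftrightarrow> (\<forall>s\<in>S. \<rho> v s \<noteq> \<rho> u s)"
    and diff: "\<And>u v. u \<in> verts G \<Longrightarrow> v \<in> verts G \<Longrightarrow> u \<noteq> v \<Longrightarrow> \<exists>s\<in>S. \<rho> v s \<noteq> \<rho> u s"
  shows "\<exists>\<pi>. derangement_representation k G \<pi>"
proof -
  obtain b where b: "bij_betw b {1..k} S"
    using S by (metis card_atLeastAtMost diff_Suc_1 finite_atLeastAtMost finite_same_card_bij)
  define b' where "b' = inv_into {1..k} b"
  have b': "bij_betw b' S {1..k}" unfolding b'_def using b by (rule bij_betw_inv_into)
  define \<pi> where "\<pi> v i = (if i \<in> {1..k} then b' (\<rho> v (b i)) else i)" for v i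
  have agree: "\<pi> v i = \<pi> u i \<longleftrightarrow> \<rho> v (b i) = \<rho> u (b i)"
    if "u \<in> verts G" "v \<in> verts G" "i \<in> {1..k}" for u v i
  proof -
    have "\<rho> v (b i) \<in> S" "\<rho> u (b i) \<in> S"
      using that bij[of v] bij[of u] b by (auto dest!: bij_betwE)
    then show ?thesis
      using that(3) by (simp add: \<pi>_def inj_on_eq_iff[OF bij_betw_imp_inj_on[OF b']])
  qed
  have positions: "(\<forall>s\<in>S. P s) \<longleftrightarrow> (\<forall>i\<in>{1..k}. P (b i))" for P
    using b by (auto simp: bij_betw_def)
  have "\<pi> v permutes {1..k}" if "v \<in> verts G" for v
  proof (rule bij_imp_permutes)
    have "bij_betw (b' \<circ> (\<rho> v \<circ> b)) {1..k} {1..k}"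
      using b b' bij[OF that] by (blast intro: bij_betw_trans)
    then show "bij_betw (\<pi> v) {1..k} {1..k}"
      by (rule bij_betw_cong[THEN iffD1, rotated]) (simp add: \<pi>_def)
  qed (auto simp: \<pi>_def)
  moreover have "inj_on \<pi> (verts G)"
  proof (rule inj_onI, rule ccontr)
    fix u v assume uv: "u \<in> verts G" "v \<in> verts G" "\<pi> u = \<pi> v" "u \<noteq> v"
    have "\<forall>i\<in>{1..k}. \<rho> v (b i) = \<rho> u (b i)"
      using agree uv by metis
    then show False
      using positions[of "\<lambda>s. \<rho> v s = \<rho> u s"] diff uv by blast
  qed
  moreover have "adjacent G u v \<longleftrightarrow> (\<forall>i\<in>{1..k}. \<pi> v i \<noteq> \<pi> u i)"
    if "u \<in> verts G" "v \<in> verts G" "u \<noteq> v" for u v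
    using adj[OF that] positions[of "\<lambda>s. \<rho> v s \<noteq> \<rho> u s"] agree that by simp
  ultimately show ?thesis
    unfolding derangement_representation_def by blast
qed

section \<open>Cliques and lower bounds\<close>

lemma drn_le:
  assumes "derangement_representation k G \<pi>" "k \<ge> 1"
  shows "drn G \<le> enat k"
  unfolding drn_def using assms by (blast intro: INF_lower)

lemma le_drn:
  assumes "\<And>k \<pi>. k \<ge> 1 \<Longrightarrow> derangement_representation k G \<pi> \<Longrightarrow> n \<le> k"
  shows "enat n \<le> drn G"
  unfolding drn_def using assms by (auto intro!: INF_greatest)

definition clique :: "'a graph \<Rightarrow> 'a set \<Rightarrow> bool" where
  "clique G K \<longleftrightarrow> K \<subseteq> verts G \<and> (\<forall>u\<in>K. \<forall>v\<in>K. u \<noteq> v \<longrightarrow> adjacent G u v)"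

lemma representation_in_range:
  assumes "derangement_representation k G \<pi>" "v \<in> verts G" "i \<in> {1..k}"
  shows "\<pi> v i \<in> {1..k}"
  using assms unfolding derangement_representation_def by (metis permutes_in_image)

lemma representation_inj_on_clique:
  assumes "derangement_representation k G \<pi>" "clique G K" "i \<in> {1..k}"
  shows "inj_on (\<lambda>v. \<pi> v i) K"
  using assms unfolding derangement_representation_def clique_def inj_on_def
  by (metis subsetD)

lemma clique_size_le:
  assumes "derangement_representation k G \<pi>" "clique G K" "k \<ge> 1"
  shows "card K \<le> k"
proof -
  have "(\<lambda>v. \<pi> v 1) ` K \<subseteq> {1..k}"
    using assms by (auto simp: clique_def subset_eq dest!: representation_in_range[of k G \<pi> _ 1])
  then show ?thesis
    using card_inj_on_le[OF representation_inj_on_clique[OF assms(1,2), of 1], of "{1..k}"]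
      assms(3) by simp
qed

text \<open>A clique of size \<open>k\<close> takes every value at every position, so a vertex that is adjacent to
  all of the clique except \<open>y\<close> can only copy \<open>y\<close>, against injectivity.\<close>

lemma clique_size_neq:
  assumes rep: "derangement_representation k G \<pi>" and K: "clique G K"
    and x: "x \<in> verts G" "x \<notin> K" and y: "y \<in> K"
    and adj: "\<And>v. v \<in> K \<Longrightarrow> v \<noteq> y \<Longrightarrow> adjacent G v x"
  shows "card K \<noteq> k"
proof
  assume card: "card K = k"
  have K_verts: "K \<subseteq> verts G" using K by (simp add: clique_def)
  have "\<pi> x i = \<pi> y i" for i
  proof (cases "i \<in> {1..k}")
    case True
    have "(\<lambda>v. \<pi> v i) ` K \<subseteq> {1..k}"
      using K_verts representation_in_range[OF rep _ True] by blast
    moreover have "card ((\<lambda>v. \<pi> v i) ` K) = k"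
      using card_image[OF representation_inj_on_clique[OF rep K True]] card by simp
    ultimately have "(\<lambda>v. \<pi> v i) ` K = {1..k}"
      by (intro card_subset_eq) simp_all
    moreover have "\<pi> x i \<in> {1..k}"
      using representation_in_range[OF rep x(1) True] .
    ultimately obtain v where v: "v \<in> K" "\<pi> x i = \<pi> v i"
      by (metis imageE)
    have "v = y"
    proof (rule ccontr)
      assume "v \<noteq> y"
      moreover have "v \<noteq> x" "v \<in> verts G" using v x K_verts by auto
      ultimately show False
        using rep adj[OF v(1)] v(2) x(1) True
        unfolding derangement_representation_def by blast
    qed
    with v(2) show ?thesis by simp
  next
    case False
    have "\<pi> x permutes {1..k}" "\<pi> y permutes {1..k}"
      using rep x y K_verts unfolding derangement_representation_def by blast+
    with False show ?thesis by (simp add: permutes_not_in)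
  qed
  then have "\<pi> x = \<pi> y" by blast
  then have "x = y"
    using rep x y K_verts unfolding derangement_representation_def by (meson inj_onD subsetD)
  with x y show False by simp
qed

section \<open>Cyclic shifts and complete graphs\<close>

lemma shift_eq_iff:
  fixes i a b m :: nat
  assumes "a < m" "b < m"
  shows "(i + a) mod m = (i + b) mod m \<longleftrightarrow> a = b"
proof -
  have "(i + a) mod m = (i + b) mod m \<longleftrightarrow> a mod m = b mod m"
    by (simp add: nat_mod_eq_iff add.assoc)
  with assms show ?thesis by simp
qed

lemma bij_betw_shift:
  fixes a m :: nat
  assumes "m > 0"
  shows "bij_betw (\<lambda>i. (i + a) mod m) {0..<m} {0..<m}"
proof -
  have "inj_on (\<lambda>i. (i + a) mod m) {0..<m}"
    by (rule inj_onI) (metis add.commute atLeastLessThan_iff shift_eq_iff)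
  moreover have "(\<lambda>i. (i + a) mod m) ` {0..<m} \<subseteq> {0..<m}"
    using assms by auto
  ultimately show ?thesis
    by (simp add: bij_betw_def endo_inj_surj)
qed

lemma drn_complete_graph:
  assumes "finite V" "card V = n" "n \<ge> 1"
  shows "drn (complete_graph V) = enat n"
proof (rule antisym)
  obtain f where f: "bij_betw f V {0..<n}"
    using assms ex_bij_betw_finite_nat by blast
  have "\<exists>\<pi>. derangement_representation n (complete_graph V) \<pi>"
  proof (rule representation_on_positions[where S = "{0..<n}" and \<rho> = "\<lambda>v i. (i + f v) mod n"])
    have "f v < n" if "v \<in> V" for v
      using f that by (auto dest: bij_betwE)
    then have neq: "(i + f v) mod n \<noteq> (i + f u) mod n" if "u \<in> V" "v \<in> V" "u \<noteq> v" for u v i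
      using that by (simp add: shift_eq_iff inj_on_eq_iff[OF bij_betw_imp_inj_on[OF f]])
    fix u v assume uv: "u \<in> verts (complete_graph V)" "v \<in> verts (complete_graph V)" "u \<noteq> v"
    then show "adjacent (complete_graph V) u v \<longleftrightarrow>
        (\<forall>i\<in>{0..<n}. (i + f v) mod n \<noteq> (i + f u) mod n)"
      using neq by (simp add: adjacent_def complete_graph_def)
    show "\<exists>i\<in>{0..<n}. (i + f v) mod n \<noteq> (i + f u) mod n"
      using neq[of u v 0] uv assms(3) by (intro bexI[of _ 0]) (auto simp: complete_graph_def)
  qed (use assms bij_betw_shift in auto)
  then show "drn (complete_graph V) \<le> enat n"
    using drn_le assms(3) by blast
  have "clique (complete_graph V) V"
    by (auto simp: clique_def adjacent_def complete_graph_def)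
  then show "enat n \<le> drn (complete_graph V)"
    using le_drn clique_size_le assms(2) by metis
qed

section \<open>Complete graphs with one edge deleted\<close>

text \<open>The three involutions that replace the shifts by \<open>0\<close>, \<open>1\<close> and \<open>-1\<close> are \<open>cut n\<close> and
  \<open>paired sw n\<close>, where \<open>sw\<close> says whether the last two points are swapped; the points below \<open>n - 2\<close> are
  paired up from \<open>0\<close> on, which leaves \<open>n - 3\<close> fixed if \<open>n\<close> is odd. That is harmless, as the cut
  moves \<open>n - 3\<close>.\<close>

definition paired :: "bool \<Rightarrow> nat \<Rightarrow> nat \<Rightarrow> nat" where
  "paired sw n i =
     (if i < n - 2 then if odd i then i - 1 else if i + 1 < n - 2 then i + 1 else i
      else if sw then if i = n - 2 then n - 1 else n - 2
      else i)"

definition cut :: "nat \<Rightarrow> nat \<Rightarrow> nat" where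
  "cut n i =
     (if i = 0 then n - 1 else if i = n - 1 then 0
      else if i = n - 2 then n - 3 else if i = n - 3 then n - 2 else i)"

lemma bij_betw_involution:
  assumes "\<And>i. i \<in> S \<Longrightarrow> f i \<in> S" "\<And>i. i \<in> S \<Longrightarrow> f (f i) = i"
  shows "bij_betw f S S"
  using assms by (intro bij_betw_byWitness[where f' = f]) auto

lemma bij_betw_paired:
  assumes "n \<ge> 4" shows "bij_betw (paired sw n) {0..<n} {0..<n}"
  using assms by (intro bij_betw_involution) (auto simp: paired_def elim!: oddE)

lemma bij_betw_cut:
  assumes "n \<ge> 4" shows "bij_betw (cut n) {0..<n} {0..<n}"
  using assms by (intro bij_betw_involution) (auto simp: cut_def)

lemma cut_neq_paired:
  assumes "n \<ge> 4" "i < n" shows "cut n i \<noteq> paired sw n i"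
proof -
  obtain m where "n = m + 4"
    using assms(1) le_Suc_ex by (metis add.commute)
  with assms(2) show ?thesis
    by (auto simp: cut_def paired_def numeral_eq_Suc split: if_splits)
qed

text \<open>Moving by at most one step on the cycle is what keeps a map apart from the shifts by
  \<open>2, \<dots>, n - 2\<close>.\<close>

lemma short_step_neq_shift:
  fixes i j n d :: nat
  assumes "i < n" "j = i \<or> j = i + 1 \<or> i = j + 1 \<or> i = 0 \<and> j = n - 1 \<or> i = n - 1 \<and> j = 0"
    and "2 \<le> d" "d \<le> n - 2"
  shows "j \<noteq> (i + d) mod n"
proof (cases "i + d < n")
  case False
  then have "(i + d) mod n = i + d - n"
    using assms by (simp add: le_mod_geq)
  with False assms show ?thesis by auto
qed (use assms in auto)

lemma paired_neq_shift:
  assumes "n \<ge> 4" "i < n" "2 \<le> d" "d \<le> n - 2"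
  shows "paired sw n i \<noteq> (i + d) mod n"
  by (rule short_step_neq_shift) (use assms in \<open>auto simp: paired_def elim!: oddE\<close>)

lemma cut_neq_shift:
  assumes "n \<ge> 4" "i < n" "2 \<le> d" "d \<le> n - 2"
  shows "cut n i \<noteq> (i + d) mod n"
proof (rule short_step_neq_shift)
  obtain m where "n = m + 4"
    using assms(1) le_Suc_ex by (metis add.commute)
  then show "cut n i = i \<or> cut n i = i + 1 \<or> i = cut n i + 1 \<or>
      i = 0 \<and> cut n i = n - 1 \<or> i = n - 1 \<and> cut n i = 0"
    by (auto simp: cut_def)
qed (use assms in auto)

lemma drn_complete_graph_delete_edge:
  assumes V: "finite V" "card V = n" "n \<ge> 4" and xy: "x \<in> V" "y \<in> V" "x \<noteq> y"
  shows "drn (delete_edge (complete_graph V) {x, y}) = enat n" (is "drn ?G = _")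
proof (rule antisym)
  have verts: "verts ?G = V"
    by (simp add: delete_edge_def complete_graph_def)
  have adj: "adjacent ?G u v \<longleftrightarrow> {u, v} \<noteq> {x, y}" if "u \<in> V" "v \<in> V" "u \<noteq> v" for u v
    using that by (simp add: adjacent_def delete_edge_def complete_graph_def)
  have "card (V - {x, y}) = card {1..n-2}"
    using V xy by (simp add: card_Diff_subset)
  then obtain f where f: "bij_betw f (V - {x, y}) {1..n-2}"
    using V(1) by (metis finite_Diff finite_atLeastAtMost finite_same_card_bij)
  have f_range: "1 \<le> f v \<and> f v \<le> n - 2" if "v \<in> V" "v \<noteq> x" "v \<noteq> y" for v
    using f that by (auto dest!: bij_betwE)
  have f_eq: "f u = f v \<longleftrightarrow> u = v"
    if "u \<in> V" "v \<in> V" "u \<notin> {x, y}" "v \<notin> {x, y}" for u v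
    using that by (simp add: inj_on_eq_iff[OF bij_betw_imp_inj_on[OF f]])
  \<comment> \<open>The vertices other than \<open>x\<close> and \<open>y\<close> are numbered from 1: number 1 takes the cut and
    number \<open>d \<ge> 2\<close> the shift by \<open>d\<close>.\<close>
  define \<rho> where "\<rho> v =
    (if v = x then paired False n else if v = y then paired True n
     else if f v = 1 then cut n else (\<lambda>i. (i + f v) mod n))" for v
  have bij: "bij_betw (\<rho> v) {0..<n} {0..<n}" for v
    using V(3) by (auto simp: \<rho>_def bij_betw_paired bij_betw_cut bij_betw_shift)
  have neq: "\<rho> v i \<noteq> \<rho> u i"
    if "u \<in> V" "v \<in> V" "u \<noteq> v" "{u, v} \<noteq> {x, y}" "i < n" for u v i
  proof -
    have one_way: "\<rho> v i \<noteq> \<rho> u i"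
      if uv: "u \<in> V" "v \<in> V" "u \<noteq> v" "v \<notin> {x, y}" for u v
    proof (cases "u \<in> {x, y}")
      case True
      then show ?thesis
        using f_range[of v] uv V(3) \<open>i < n\<close> cut_neq_paired[of n i]
          paired_neq_shift[of n i "f v" False] paired_neq_shift[of n i "f v" True]
        by (auto simp: \<rho>_def)
    next
      case False
      then have "f u < n" "f v < n"
        using f_range[of u] f_range[of v] uv V(3) by auto
      with False show ?thesis
        using f_range[of u] f_range[of v] f_eq[of u v] uv V(3) \<open>i < n\<close>
          cut_neq_shift[of n i "f u"] cut_neq_shift[of n i "f v"] shift_eq_iff[of "f v" n "f u" i]
        by (auto simp: \<rho>_def)
    qed
    have "v \<notin> {x, y} \<or> u \<notin> {x, y}"
      using that by auto
    then show ?thesis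
      using one_way that by metis
  qed
  have agree: "\<rho> x 0 = \<rho> y 0" and differ: "\<rho> x (n - 1) \<noteq> \<rho> y (n - 1)"
    using V(3) xy(3) by (auto simp: \<rho>_def paired_def)
  have "\<exists>\<pi>. derangement_representation n ?G \<pi>"
  proof (rule representation_on_positions[where S = "{0..<n}" and \<rho> = \<rho>])
    fix u v assume "u \<in> verts ?G" "v \<in> verts ?G" "u \<noteq> v"
    then have uv: "u \<in> V" "v \<in> V" "u \<noteq> v" by (simp_all add: verts)
    show "adjacent ?G u v \<longleftrightarrow> (\<forall>i\<in>{0..<n}. \<rho> v i \<noteq> \<rho> u i)"
    proof (cases "{u, v} = {x, y}")
      case True
      then have "\<rho> v 0 = \<rho> u 0" using agree by (auto simp: doubleton_eq_iff)
      then show ?thesis using True V(3) adj[OF uv] by force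
    next
      case False
      then show ?thesis using adj[OF uv] neq[OF uv] by simp
    qed
    show "\<exists>i\<in>{0..<n}. \<rho> v i \<noteq> \<rho> u i"
    proof (rule bexI)
      show "\<rho> v (n - 1) \<noteq> \<rho> u (n - 1)"
        using differ neq[OF uv] V(3) by (cases "{u, v} = {x, y}") (auto simp: doubleton_eq_iff)
    qed (use V(3) in auto)
  qed (use bij in auto)
  then show "drn ?G \<le> enat n"
    using drn_le V(3) by (metis le_trans one_le_numeral)
  show "enat n \<le> drn ?G"
  proof (rule le_drn)
    fix k \<pi> assume k: "1 \<le> k" and rep: "derangement_representation k ?G \<pi>"
    have clique: "clique ?G (V - {x})"
      using adj by (auto simp: clique_def verts)
    have card: "card (V - {x}) = n - 1"
      using V xy by simp
    have "n - 1 \<le> k"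
      using clique_size_le[OF rep clique k] card by simp
    moreover have "n - 1 \<noteq> k"
      using clique_size_neq[OF rep clique, of x y] xy adj card
      by (auto simp: verts doubleton_eq_iff)
    ultimately show "n \<le> k" by simp
  qed
qed

section \<open>One block of positions for every missing edge\<close>

text \<open>Giving both ends of the pair one label saves a label, so that the block of a missing edge
  needs only \<open>card V - 1\<close> positions.\<close>

lemma labelling_identifying_a_pair:
  assumes "finite V" "e \<in> nsets V 2"
  shows "\<exists>c. (\<forall>v\<in>V. c v < card V - 1) \<and>
             (\<forall>u\<in>V. \<forall>v\<in>V. u \<noteq> v \<longrightarrow> (c u = c v \<longleftrightarrow> {u, v} = e))"
proof -
  obtain a b where e: "e = {a, b}" and ab: "a \<in> V" "b \<in> V" "a \<noteq> b"
    using assms(2) by (auto simp: nsets_def card_2_iff)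
  obtain f where f: "bij_betw f (V - {b}) {0..<card V - 1}"
    using ex_bij_betw_finite_nat[of "V - {b}"] assms(1) ab by auto
  define c where "c v = f (if v = b then a else v)" for v
  have "c v < card V - 1" if "v \<in> V" for v
    using f that ab by (auto simp: c_def dest!: bij_betwE)
  moreover have "c u = c v \<longleftrightarrow> {u, v} = e" if "u \<in> V" "v \<in> V" "u \<noteq> v" for u v
    using f that ab by (auto simp: c_def e bij_betw_def inj_on_eq_iff doubleton_eq_iff)
  ultimately show ?thesis by blast
qed

text \<open>The positions are pairs of a missing edge, naming the block, and a residue modulo
  \<open>card V - 1\<close>.\<close>

lemma drn_le_blocks:
  assumes G: "finite_simple_graph G" and two: "num_edges (complement G) \<ge> 2"
  shows "drn G \<le> enat ((order G - 1) * num_edges (complement G))"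
proof -
  define V where "V = verts G"
  define E where "E = edges (complement G)"
  define m where "m = card V - 1"
  have fin: "finite V" using G by (simp add: finite_simple_graph_def V_def)
  have E: "E \<subseteq> nsets V 2" "card E \<ge> 2" "finite E"
    using two fin
    by (auto simp: E_def V_def complement_def num_edges_def finite_imp_finite_nsets)
  have adj: "adjacent G u v \<longleftrightarrow> {u, v} \<notin> E" if "u \<in> V" "v \<in> V" "u \<noteq> v" for u v
    using that by (simp add: adjacent_def E_def V_def complement_def)
  have "\<forall>e\<in>E. \<exists>c. (\<forall>v\<in>V. c v < m) \<and>
      (\<forall>u\<in>V. \<forall>v\<in>V. u \<noteq> v \<longrightarrow> (c u = c v \<longleftrightarrow> {u, v} = e))"
    using labelling_identifying_a_pair[OF fin] E(1) unfolding m_def by blast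
  from bchoice[OF this] obtain c where labelling:
    "\<forall>e\<in>E. (\<forall>v\<in>V. c e v < m) \<and>
      (\<forall>u\<in>V. \<forall>v\<in>V. u \<noteq> v \<longrightarrow> (c e u = c e v \<longleftrightarrow> {u, v} = e))" ..
  have c: "c e v < m" if "e \<in> E" "v \<in> V" for e v
    using labelling that by simp
  have c_eq: "c e u = c e v \<longleftrightarrow> {u, v} = e" if "e \<in> E" "u \<in> V" "v \<in> V" "u \<noteq> v" for e u v
    using labelling that by simp
  \<comment> \<open>Having two missing edges is what separates the ends of each of them.\<close>
  have other: "\<exists>e\<in>E. e \<noteq> d" for d
  proof (rule ccontr)
    assume "\<not> ?thesis"
    then have "card E \<le> card {d}" by (intro card_mono) auto
    then show False using E(2) by simp
  qed
  have "m > 0"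
  proof -
    obtain e where "e \<in> E" using other by blast
    moreover obtain v where "v \<in> V" using \<open>e \<in> E\<close> E(1) by (auto simp: nsets_def card_2_iff)
    ultimately show ?thesis using c by fastforce
  qed
  define \<rho> where "\<rho> v s = (fst s, (snd s + c (fst s) v) mod m)" for v and s :: "'a set \<times> nat"
  have agree: "\<rho> v s = \<rho> u s \<longleftrightarrow> {u, v} = fst s"
    if "u \<in> V" "v \<in> V" "u \<noteq> v" "fst s \<in> E" for u v s
    using that c shift_eq_iff[of "c (fst s) v" m "c (fst s) u"] c_eq[of "fst s" u v]
    by (auto simp: \<rho>_def)
  have "\<exists>\<pi>. derangement_representation (m * card E) G \<pi>"
  proof (rule representation_on_positions[where S = "E \<times> {0..<m}" and \<rho> = \<rho>])
    show "finite (E \<times> {0..<m})" "card (E \<times> {0..<m}) = m * card E"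
      using E(3) by (auto simp: card_cartesian_product)
    fix v
    have "inj_on (\<rho> v) (E \<times> {0..<m})"
    proof (rule inj_onI)
      fix s t assume "s \<in> E \<times> {0..<m}" "t \<in> E \<times> {0..<m}" "\<rho> v s = \<rho> v t"
      then show "s = t"
        using bij_betw_shift[OF \<open>m > 0\<close>, of "c (fst s) v"]
        by (auto simp: \<rho>_def bij_betw_def inj_on_def)
    qed
    moreover have "\<rho> v ` (E \<times> {0..<m}) \<subseteq> E \<times> {0..<m}"
      using \<open>m > 0\<close> by (auto simp: \<rho>_def)
    ultimately show "bij_betw (\<rho> v) (E \<times> {0..<m}) (E \<times> {0..<m})"
      using E(3) by (simp add: bij_betw_def endo_inj_surj)
  next
    fix u v assume "u \<in> verts G" "v \<in> verts G" "u \<noteq> v"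
    then have uv: "u \<in> V" "v \<in> V" "u \<noteq> v" by (simp_all add: V_def)
    show "adjacent G u v \<longleftrightarrow> (\<forall>s\<in>E \<times> {0..<m}. \<rho> v s \<noteq> \<rho> u s)"
      using adj[OF uv] agree[OF uv] \<open>m > 0\<close> by force
    obtain e where "e \<in> E" "e \<noteq> {u, v}" using other by blast
    then show "\<exists>s\<in>E \<times> {0..<m}. \<rho> v s \<noteq> \<rho> u s"
      using agree[OF uv, of "(e, 0)"] \<open>m > 0\<close> by (intro bexI[of _ "(e, 0)"]) auto
  qed
  moreover have "m * card E \<ge> 1"
    using \<open>m > 0\<close> E(2) by (simp add: Suc_le_eq)
  ultimately have "drn G \<le> enat (m * card E)"
    using drn_le by blast
  then show ?thesis
    by (simp add: m_def V_def E_def order_def num_edges_def)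
qed

theorem theorem4:
  shows "(\<forall>n\<ge>1. \<forall>V :: 'a set. finite V \<and> card V = n \<longrightarrow> drn (complete_graph V) = enat n)
    \<and> (\<forall>n\<ge>4. \<forall>V :: 'a set. \<forall>x\<in>V. \<forall>y\<in>V. finite V \<and> card V = n \<and> x \<noteq> y \<longrightarrow>
         drn (delete_edge (complete_graph V) {x, y}) = enat n)
    \<and> (\<forall>n. \<forall>G :: 'a graph. finite_simple_graph G \<and> order G = n \<and> num_edges (complement G) \<ge> 2 \<longrightarrow>
         drn G \<le> enat ((n - 1) * num_edges (complement G)))"
  by (auto simp del: One_nat_def
      intro!: drn_complete_graph drn_complete_graph_delete_edge drn_le_blocks)

end
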